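(* Let $A_Q/\hat{\lambda}$ be the operator defined by $(A_Q/\hat{\lambda})f=\frac{A_Qf}{\hat{\lambda}}$ for $f\in D(A_Q)$. Then the operator $\operatorname{id}-A_Q/\hat{\lambda}:D(A_Q)\to C_b(X)$ is invertible, and its inverse is the operator on $C_b(X)$ induced by the kernel $G$. Equivalently, $$Gf\in D(A_Q)\quad\text{and}\quad Gf-\frac{A_QGf}{\hat{\lambda}}=f\quad\text{for any } f\in C_b(X),$$ $$Gf-G\left(\frac{A_Qf}{\hat{\lambda}}\right)=f\quad\text{for any } f\in D(A_Q).$$
   Context: Notation. $\mathbb{R}_+=[0,\infty)$. For a metric space $E$: $\mathcal{B}(E)$ is the Borel $\sigma$-field, $B_b(E)$ the bounded Borel functions $E\to\mathbb{R}$ with the supremum norm, $C_b(E)$ the continuous ones among them, $\mathcal{M}_{sig}(E)$ the finite signed Borel measures. For a kernel $K$ on $E$, $Kf(x)=\int_E f(y)\,K(x,dy)$. Setting. $(Y,\rho_Y)$ is a non-empty complete separable metric space, $I$ is a non-empty finite set with the discrete topology, $X:=Y\times I$ with the product topology. $\{S_i: i\in I\}$ are jointly continuous semiflows $S_i:\mathbb{R}_+\times Y\to Y$, i.e. $S_i(s,S_i(t,y))=S_i(s+t,y)$ and $S_i(0,y)=y$. $\lambda:Y\to(0,\infty)$ is continuous with $\underline{\lambda}\le\lambda(y)\le\bar{\lambda}$ for all $y\in Y$, for constants $\underline{\lambda},\bar{\lambda}>0$. Put $\hat{\lambda}(y,i):=\lambda(y)$ for $(y,i)\in X$ and $\Lambda(y,i,t):=\int_0^t\lambda(S_i(h,y))\,dh$.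 The stochastic kernel $G$ on $X$ is $$G((y,i),A)=\int_0^\infty\lambda(S_i(t,y))e^{-\Lambda(y,i,t)}\mathbf{1}_A(S_i(t,y),i)\,dt,\quad A\in\mathcal{B}(X).$$ It maps $C_b(X)$ into itself. Weak generators. For functions $f_t,f\in B_b(E)$, $w^*\text{-}\lim_{t\to0}f_t=f$ means $\lim_{t\to0}\int f_t\,d\mu=\int f\,d\mu$ for every $\mu\in\mathcal{M}_{sig}(E)$. Given a contraction semigroup $\{H_t\}_{t\in\mathbb{R}_+}$ of linear operators on a subspace $L$ of $B_b(E)$, let $L_{0,H}:=\{f\in L: w^*\text{-}\lim_{t\to0}H_tf=f\}$. The weak generator $A_H$ of $\{H_t\}$ has domain $$D(A_H)=\Big\{f\in L:\ w^*\text{-}\lim_{t\to0}\tfrac{H_tf-f}{t}\text{ exists and belongs to }L_{0,H}\Big\},\qquad A_Hf=w^*\text{-}\lim_{t\to0}\tfrac{H_tf-f}{t}.$$ $A_Q$ denotes the weak generator of the semigroup $\{Q_t\}_{t\in\mathbb{R}_+}$ on $L=C_b(X)$ given by $Q_tf(y,i)=f(S_i(t,y),i)$. *)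

theory Defs
  imports "HOL-Analysis.Analysis"
begin

subsection \<open>Function spaces and signed measures\<close>

abbreviation bounded_cont :: "('a::topological_space \<Rightarrow> real) set" where
  "bounded_cont \<equiv> bcontfun"

definition bounded_borel :: "('a::topological_space \<Rightarrow> real) set" where
  "bounded_borel = {f. f \<in> borel_measurable borel \<and> bounded (range f)}"

text \<open>Only the values of \<open>\<mu>\<close> on Borel sets are relevant.\<close>

definition finite_signed_measure :: "('a::topological_space set \<Rightarrow> real) \<Rightarrow> bool" where
  "finite_signed_measure \<mu> \<longleftrightarrow> \<mu> {} = 0 \<and>
     (\<forall>A. range A \<subseteq> sets borel \<longrightarrow> disjoint_family A \<longrightarrow>
        (\<lambda>n::nat. \<mu> (A n)) sums \<mu> (\<Union>n. A n))"

text \<open>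
  The positive part of the Jordan decomposition (upper variation); the negative part is the
  positive part of \<open>-\<mu>\<close>. Negative values of \<open>\<mu> B\<close> are cut off by \<open>ennreal\<close>, which does not
  change the supremum, since \<open>B = {}\<close> contributes \<open>0\<close>.
\<close>

definition pos_part :: "('a::topological_space set \<Rightarrow> real) \<Rightarrow> 'a measure" where
  "pos_part \<mu> = measure_of UNIV (sets borel)
     (\<lambda>A. SUP B\<in>{B \<in> sets borel. B \<subseteq> A}. ennreal (\<mu> B))"

definition signed_integral :: "('a::topological_space set \<Rightarrow> real) \<Rightarrow> ('a \<Rightarrow> real) \<Rightarrow> real" where
  "signed_integral \<mu> f = (\<integral>x. f x \<partial>pos_part \<mu>) - (\<integral>x. f x \<partial>pos_part (\<lambda>A. - \<mu> A))"


subsection \<open>Weak generators\<close>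

definition wstar_lim :: "(real \<Rightarrow> 'a::topological_space \<Rightarrow> real) \<Rightarrow> ('a \<Rightarrow> real) \<Rightarrow> bool" where
  "wstar_lim F f \<longleftrightarrow> (\<forall>t>0. F t \<in> bounded_borel) \<and> f \<in> bounded_borel \<and>
     (\<forall>\<mu>. finite_signed_measure \<mu> \<longrightarrow>
        ((\<lambda>t. signed_integral \<mu> (F t)) \<longlongrightarrow> signed_integral \<mu> f) (at_right 0))"

text \<open>
  In the following, \<open>L\<close> is the subspace on which the semigroup \<open>H\<close> acts; \<open>H t\<close> matters only for
  \<open>t \<ge> 0\<close> and only on \<open>L\<close>.
\<close>

definition weak_continuity_space ::
    "('a::topological_space \<Rightarrow> real) set \<Rightarrow> (real \<Rightarrow> ('a \<Rightarrow> real) \<Rightarrow> 'a \<Rightarrow> real) \<Rightarrow> ('a \<Rightarrow> real) set" where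
  "weak_continuity_space L H = {f \<in> L. wstar_lim (\<lambda>t. H t f) f}"

definition generator_domain ::
    "('a::topological_space \<Rightarrow> real) set \<Rightarrow> (real \<Rightarrow> ('a \<Rightarrow> real) \<Rightarrow> 'a \<Rightarrow> real) \<Rightarrow> ('a \<Rightarrow> real) set" where
  "generator_domain L H =
     {f \<in> L. \<exists>g \<in> weak_continuity_space L H. wstar_lim (\<lambda>t x. (H t f x - f x) / t) g}"

text \<open>
  Testing against Dirac measures shows that weak limits are unique, so the description is
  well-defined on the domain.
\<close>

definition generator ::
    "(real \<Rightarrow> ('a::topological_space \<Rightarrow> real) \<Rightarrow> 'a \<Rightarrow> real) \<Rightarrow> ('a \<Rightarrow> real) \<Rightarrow> 'a \<Rightarrow> real" where
  "generator H f = (THE g. wstar_lim (\<lambda>t x. (H t f x - f x) / t) g)"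


subsection \<open>The semiflows, the transport semigroup and the kernel\<close>

definition kernel_op :: "('a \<Rightarrow> 'a measure) \<Rightarrow> ('a \<Rightarrow> real) \<Rightarrow> 'a \<Rightarrow> real" where
  "kernel_op K f x = (\<integral>y. f y \<partial>K x)"

definition jointly_continuous_semiflow :: "(real \<Rightarrow> 'y::topological_space \<Rightarrow> 'y) \<Rightarrow> bool" where
  "jointly_continuous_semiflow \<phi> \<longleftrightarrow>
     continuous_on ({0..} \<times> UNIV) (\<lambda>(t, y). \<phi> t y) \<and>
     (\<forall>y. \<phi> 0 y = y) \<and>
     (\<forall>s\<ge>0. \<forall>t\<ge>0. \<forall>y. \<phi> s (\<phi> t y) = \<phi> (s + t) y)"

definition transport ::
    "('i \<Rightarrow> real \<Rightarrow> 'y \<Rightarrow> 'y) \<Rightarrow> real \<Rightarrow> ('y \<times> 'i \<Rightarrow> real) \<Rightarrow> 'y \<times> 'i \<Rightarrow> real" where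
  "transport S t f = (\<lambda>(y, i). f (S i t y, i))"

definition rate_hat :: "('y \<Rightarrow> real) \<Rightarrow> 'y \<times> 'i \<Rightarrow> real" where
  "rate_hat rate = (\<lambda>(y, i). rate y)"

definition cumulative_rate ::
    "('i \<Rightarrow> real \<Rightarrow> 'y \<Rightarrow> 'y) \<Rightarrow> ('y \<Rightarrow> real) \<Rightarrow> 'y \<Rightarrow> 'i \<Rightarrow> real \<Rightarrow> real" where
  "cumulative_rate S rate y i t = (LBINT h:{0..t}. rate (S i h y))"

definition G_kernel ::
    "('i \<Rightarrow> real \<Rightarrow> 'y \<Rightarrow> 'y) \<Rightarrow> ('y \<Rightarrow> real) \<Rightarrow> 'y \<times> 'i \<Rightarrow>
       ('y::topological_space \<times> 'i::topological_space) measure" where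
  "G_kernel S rate = (\<lambda>(y, i). measure_of UNIV (sets borel)
     (\<lambda>A. \<integral>\<^sup>+t\<in>{0..}. (ennreal (rate (S i t y) * exp (- cumulative_rate S rate y i t))
                      * indicator A (S i t y, i)) \<partial>lborel))"

definition Q_domain ::
    "('i::topological_space \<Rightarrow> real \<Rightarrow> 'y::topological_space \<Rightarrow> 'y) \<Rightarrow> ('y \<times> 'i \<Rightarrow> real) set" where
  "Q_domain S = generator_domain bounded_cont (transport S)"

definition Q_generator ::
    "('i::topological_space \<Rightarrow> real \<Rightarrow> 'y::topological_space \<Rightarrow> 'y) \<Rightarrow>
       ('y \<times> 'i \<Rightarrow> real) \<Rightarrow> 'y \<times> 'i \<Rightarrow> real" where
  "Q_generator S = generator (transport S)"

definition scaled_generator ::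
    "('i::topological_space \<Rightarrow> real \<Rightarrow> 'y::topological_space \<Rightarrow> 'y) \<Rightarrow> ('y \<Rightarrow> real) \<Rightarrow>
       ('y \<times> 'i \<Rightarrow> real) \<Rightarrow> 'y \<times> 'i \<Rightarrow> real" where
  "scaled_generator S rate f = (\<lambda>x. Q_generator S f x / rate_hat rate x)"

definition G_op ::
    "('i::topological_space \<Rightarrow> real \<Rightarrow> 'y::topological_space \<Rightarrow> 'y) \<Rightarrow> ('y \<Rightarrow> real) \<Rightarrow>
       ('y \<times> 'i \<Rightarrow> real) \<Rightarrow> 'y \<times> 'i \<Rightarrow> real" where
  "G_op S rate = kernel_op (G_kernel S rate)"

end

theory Submission
  imports Defs "HOL-Probability.Giry_Monad" "HOL-Real_Asymp.Real_Asymp"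
begin

text \<open>
  Along a trajectory \<open>t \<mapsto> S i t y\<close> the statement is about an ordinary linear differential
  equation. Let \<open>r\<close> be the rate along the trajectory and \<open>E\<close> the survival function, so that
  \<open>E' = - r E\<close>. The generator \<open>A\<close> of the transport semigroup is differentiation along trajectories,
  and \<open>G f\<close> at the starting point is the integral of \<open>E r f\<close> over all times. Restarting at time
  \<open>s\<close> deletes the times before \<open>s\<close> and divides by \<open>E s\<close>; differentiating that quotient gives
  \<open>(G f)' = r (G f - f)\<close>, which is the identity \<open>G f - A (G f) / r = f\<close>. Conversely, for \<open>f\<close> in
  the domain, \<open>E (r f - A f)\<close> is the derivative of \<open>- E f\<close>. Its integral over all times is therefore
  \<open>f\<close> at the starting point, because \<open>E\<close> decays exponentially, and this is the identity
  \<open>G f - G (A f / r) = f\<close>. The two one-sided inverses together give bijectivity.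

  Two points need care. The generator is defined by weak convergence against signed measures:
  bounded pointwise convergence suffices for it (\<open>wstar_lim_if_bounded_pointwise\<close>, which rests on
  the boundedness of finite signed measures), and it implies pointwise convergence
  (\<open>wstar_lim_imp_pointwise\<close>). Moreover, a function in the domain is a priori only differentiable from
  the right along trajectories; a continuous function with right derivative \<open>0\<close> is still constant
  (\<open>le_if_right_derivative_nonpos\<close>).
\<close>


section \<open>Finite signed measures\<close>

lemma finite_signed_measure_additive:
  assumes \<mu>: "finite_signed_measure \<mu>" and A: "A \<in> sets borel" and B: "B \<in> sets borel"
    and "A \<inter> B = {}"
  shows "\<mu> (A \<union> B) = \<mu> A + \<mu> B"
proof -
  have 0: "\<mu> {} = 0" using \<mu> by (simp add: finite_signed_measure_def)
  have "disjoint_family (binaryset A B)"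
    using assms(4) by (auto simp: disjoint_family_on_def binaryset_def)
  moreover have "range (binaryset A B) \<subseteq> sets borel"
    using A B by (auto simp: range_binaryset_eq)
  ultimately have "(\<lambda>n. \<mu> (binaryset A B n)) sums \<mu> (\<Union>n. binaryset A B n)"
    using \<mu> by (simp add: finite_signed_measure_def)
  with binaryset_sums[of \<mu> A B, OF 0] show ?thesis
    using sums_unique2 by (simp add: UN_binaryset_eq) blast
qed

lemma finite_signed_measure_uminus:
  "finite_signed_measure \<mu> \<Longrightarrow> finite_signed_measure (\<lambda>A. - \<mu> A)"
  by (auto simp: finite_signed_measure_def intro: sums_minus)

text \<open>
  If \<open>\<mu>\<close> were unbounded on the Borel subsets of \<open>A\<close>, then some \<open>B \<subseteq> A\<close> would satisfy
  \<open>\<bar>\<mu> B\<bar> > 1 + \<bar>\<mu> A\<bar>\<close>. Then \<open>\<mu>\<close> exceeds \<open>1\<close> in absolute value on both \<open>B\<close> and \<open>A - B\<close>, and it is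
  still unbounded on one of the two. Keeping that one and splitting off the other, over and over,
  gives a disjoint sequence on which \<open>\<mu>\<close> does not tend to \<open>0\<close>, against countable additivity.
\<close>

lemma finite_signed_measure_bounded:
  fixes \<mu> :: "'a::topological_space set \<Rightarrow> real"
  assumes \<mu>: "finite_signed_measure \<mu>"
  shows "\<exists>C. \<forall>B\<in>sets borel. \<bar>\<mu> B\<bar> \<le> C"
proof (rule ccontr)
  define unb where "unb A \<longleftrightarrow> A \<in> sets borel \<and> (\<forall>C. \<exists>B\<in>sets borel. B \<subseteq> A \<and> \<bar>\<mu> B\<bar> > C)" for A
  assume "\<not> ?thesis"
  then have UNIV: "unb UNIV" by (auto simp: unb_def not_le)
  have step: "\<exists>A'. unb A' \<and> A' \<subseteq> A \<and> \<bar>\<mu> (A - A')\<bar> > 1" if A: "unb A" for A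
  proof -
    obtain B where B: "B \<in> sets borel" "B \<subseteq> A" "\<bar>\<mu> B\<bar> > 1 + \<bar>\<mu> A\<bar>"
      using A unfolding unb_def by blast
    have AB: "A \<in> sets borel" "A - B \<in> sets borel" using A B by (auto simp: unb_def)
    have "\<mu> A = \<mu> B + \<mu> (A - B)"
      using finite_signed_measure_additive[OF \<mu> B(1) AB(2)] B(2) by (simp add: Un_absorb1)
    with B(3) have big: "\<bar>\<mu> (A - B)\<bar> > 1" by linarith
    have "unb B \<or> unb (A - B)"
    proof (rule ccontr)
      assume "\<not> (unb B \<or> unb (A - B))"
      then obtain C1 C2 where
          C1: "\<And>E. E \<in> sets borel \<Longrightarrow> E \<subseteq> B \<Longrightarrow> \<bar>\<mu> E\<bar> \<le> C1" and
          C2: "\<And>E. E \<in> sets borel \<Longrightarrow> E \<subseteq> A - B \<Longrightarrow> \<bar>\<mu> E\<bar> \<le> C2"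
        using AB B(1) unfolding unb_def by (meson not_le)
      obtain E where E: "E \<in> sets borel" "E \<subseteq> A" "\<bar>\<mu> E\<bar> > C1 + C2"
        using A unfolding unb_def by blast
      have "\<mu> ((E \<inter> B) \<union> (E - B)) = \<mu> (E \<inter> B) + \<mu> (E - B)"
        using E(1) B(1) by (intro finite_signed_measure_additive[OF \<mu>]) auto
      moreover have "(E \<inter> B) \<union> (E - B) = E" by auto
      moreover have "\<bar>\<mu> (E \<inter> B)\<bar> \<le> C1" using E B by (intro C1) auto
      moreover have "\<bar>\<mu> (E - B)\<bar> \<le> C2" using E B by (intro C2) auto
      ultimately show False using E(3) by simp
    qed
    moreover have "A - (A - B) = B" using B(2) by auto
    ultimately show ?thesis
      using big B(2,3) by (metis Diff_subset abs_ge_zero add_increasing2 le_less_trans order_refl)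
  qed
  obtain A where A: "\<And>n::nat. unb (A n)" "\<And>n. A (Suc n) \<subseteq> A n" "\<And>n. \<bar>\<mu> (A n - A (Suc n))\<bar> > 1"
    using dependent_nat_choice[of "\<lambda>_. unb" "\<lambda>_ A A'. A' \<subseteq> A \<and> \<bar>\<mu> (A - A')\<bar> > 1"] UNIV step
    by metis
  have mono: "A n \<subseteq> A m" if "m \<le> n" for m n 
    by (rule lift_Suc_antimono_le[of A, OF A(2) that])
  have "disjoint_family (\<lambda>n. A n - A (Suc n))"
  proof -
    have "(A m - A (Suc m)) \<inter> (A n - A (Suc n)) = {}" if "m < n" for m n
      using mono[of "Suc m" n] that by auto
    then show ?thesis
      unfolding disjoint_family_on_def by (metis Int_commute linorder_neqE_nat)
  qed
  moreover have "range (\<lambda>n. A n - A (Suc n)) \<subseteq> sets borel"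
    using A(1) by (auto simp: unb_def)
  ultimately have "summable (\<lambda>n. \<mu> (A n - A (Suc n)))"
    using \<mu> unfolding finite_signed_measure_def summable_def by blast
  then have "(\<lambda>n. \<mu> (A n - A (Suc n))) \<longlonglongrightarrow> 0" by (rule summable_LIMSEQ_zero)
  then have "\<forall>\<^sub>F n in sequentially. \<bar>\<mu> (A n - A (Suc n))\<bar> < 1"
    by (auto dest: tendstoD[where e=1] simp: dist_real_def)
  then obtain n where "\<bar>\<mu> (A n - A (Suc n))\<bar> < 1" by (auto simp: eventually_sequentially)
  with A(3)[of n] show False by simp
qed

lemma sets_pos_part [measurable_cong, simp]:
  "sets (pos_part \<mu>) = sets (borel :: 'a::topological_space measure)"
  unfolding pos_part_def
  using sets.sigma_sets_eq[of "borel :: 'a measure"] by (subst sets_measure_of) auto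

lemma space_pos_part [simp]: "space (pos_part \<mu>) = UNIV"
  unfolding pos_part_def by (subst space_measure_of) auto

text \<open>
  If the supremum defining the positive part failed to be
  countably additive, \<^const>\<open>measure_of\<close> would yield the null measure; in either case
  the total mass is at most the bound on \<open>\<mu>\<close>.
\<close>

lemma finite_measure_pos_part:
  fixes \<mu> :: "'a::topological_space set \<Rightarrow> real"
  assumes "finite_signed_measure \<mu>"
  shows "finite_measure (pos_part \<mu>)"
proof
  obtain C where C: "\<And>B. B \<in> sets borel \<Longrightarrow> \<bar>\<mu> B\<bar> \<le> C"
    using finite_signed_measure_bounded[OF assms] by blast
  have "emeasure (pos_part \<mu>) UNIV \<le> (SUP B\<in>{B \<in> sets borel. B \<subseteq> UNIV}. ennreal (\<mu> B))"
    unfolding pos_part_def by (subst emeasure_measure_of_conv) auto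
  also have "\<dots> \<le> ennreal C"
    using C by (intro SUP_least ennreal_leI) (auto intro: order_trans[OF abs_ge_self])
  finally show "emeasure (pos_part \<mu>) (space (pos_part \<mu>)) \<noteq> \<infinity>"
    by (auto simp: top_unique)
qed


section \<open>Weak limits of bounded families\<close>

lemma tendsto_integral_bounded_at_right:
  fixes F :: "real \<Rightarrow> 'a::topological_space \<Rightarrow> real"
  assumes "finite_measure M" and M: "sets M = sets borel"
    and F: "\<And>t. t > 0 \<Longrightarrow> F t \<in> borel_measurable borel" and f: "f \<in> borel_measurable borel"
    and C: "\<And>t x. t > 0 \<Longrightarrow> \<bar>F t x\<bar> \<le> C"
    and lim: "\<And>x. ((\<lambda>t. F t x) \<longlongrightarrow> f x) (at_right 0)"
  shows "((\<lambda>t. \<integral>x. F t x \<partial>M) \<longlongrightarrow> (\<integral>x. f x \<partial>M)) (at_right 0)"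
proof -
  interpret finite_measure M by fact
  \<comment> \<open>The substitution \<open>t = 1 / s\<close> turns the limit into one at infinity; the maximum keeps \<open>t\<close> positive,
    so that measurability holds for every \<open>s\<close>.\<close>
  define F' where "F' s = F (inverse (max 1 s))" for s
  have ev: "\<forall>\<^sub>F s in at_top. F' s = F (inverse s)"
    using eventually_ge_at_top[of 1] by eventually_elim (simp add: F'_def max_def)
  have "((\<lambda>s. \<integral>x. F' s x \<partial>M) \<longlongrightarrow> (\<integral>x. f x \<partial>M)) at_top"
  proof (rule integral_dominated_convergence_at_top[where w="\<lambda>_. C"])
    show "f \<in> borel_measurable M" using f M measurable_cong_sets by blast
    show "F' s \<in> borel_measurable M" for s
      using F[of "inverse (max 1 s)"] M measurable_cong_sets unfolding F'_def by fastforce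
    show "AE x in M. ((\<lambda>s. F' s x) \<longlongrightarrow> f x) at_top"
    proof (rule AE_I2)
      fix x
      have "((\<lambda>s. F (inverse s) x) \<longlongrightarrow> f x) at_top"
        using lim[of x] by (simp add: filterlim_at_right_to_top)
      then show "((\<lambda>s. F' s x) \<longlongrightarrow> f x) at_top"
        by (rule Lim_transform_eventually) (use ev in eventually_elim, simp)
    qed
    show "\<forall>\<^sub>F s in at_top. AE x in M. norm (F' s x) \<le> C"
      using C by (intro always_eventually allI AE_I2) (simp add: F'_def)
  qed simp
  then have "((\<lambda>s. \<integral>x. F (inverse s) x \<partial>M) \<longlongrightarrow> (\<integral>x. f x \<partial>M)) at_top"
    by (rule Lim_transform_eventually) (use ev in eventually_elim, simp)
  then show ?thesis by (simp add: filterlim_at_right_to_top)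
qed

text \<open>
  Dominated convergence with respect to the two finite parts of each signed measure. Every weak
  limit below is established through this criterion.
\<close>

lemma wstar_lim_if_bounded_pointwise:
  fixes F :: "real \<Rightarrow> 'a::topological_space \<Rightarrow> real"
  assumes F: "\<And>t. t > 0 \<Longrightarrow> F t \<in> bounded_borel" and f: "f \<in> bounded_borel"
    and C: "\<And>t x. t > 0 \<Longrightarrow> \<bar>F t x\<bar> \<le> C"
    and lim: "\<And>x. ((\<lambda>t. F t x) \<longlongrightarrow> f x) (at_right 0)"
  shows "wstar_lim F f"
  unfolding wstar_lim_def
proof (intro conjI allI impI)
  fix \<mu> :: "'a set \<Rightarrow> real" assume \<mu>: "finite_signed_measure \<mu>"
  have meas: "\<And>t. t > 0 \<Longrightarrow> F t \<in> borel_measurable borel" "f \<in> borel_measurable borel"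
    using F f by (auto simp: bounded_borel_def)
  show "((\<lambda>t. signed_integral \<mu> (F t)) \<longlongrightarrow> signed_integral \<mu> f) (at_right 0)"
    unfolding signed_integral_def
    by (intro tendsto_diff tendsto_integral_bounded_at_right[OF _ _ meas C lim]
        finite_measure_pos_part finite_signed_measure_uminus \<mu> sets_pos_part)
qed (use F f in auto)

definition dirac :: "'a \<Rightarrow> 'a set \<Rightarrow> real" where
  "dirac x A = indicator A x"

lemma finite_signed_measure_dirac: "finite_signed_measure (dirac (x :: 'a::topological_space))"
  unfolding finite_signed_measure_def
proof (intro conjI allI impI)
  fix A :: "nat \<Rightarrow> 'a set" assume "disjoint_family A"
  then show "(\<lambda>n. dirac x (A n)) sums dirac x (\<Union>n. A n)"
  proof (cases "x \<in> (\<Union>n. A n)")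
    case True
    then obtain m where m: "x \<in> A m" by blast
    have "dirac x (A n) = (if n = m then 1 else 0)" for n
      using m \<open>disjoint_family A\<close> by (auto simp: dirac_def disjoint_family_on_def indicator_def)
    then show ?thesis using sums_single[of m "\<lambda>_. 1::real"] True by (auto simp: dirac_def)
  qed (auto simp: dirac_def indicator_def)
qed (simp add: dirac_def)

lemma signed_integral_dirac:
  assumes f: "f \<in> borel_measurable borel"
  shows "signed_integral (dirac (x :: 'a::topological_space)) f = f x"
proof -
  have pos: "pos_part (dirac x) = return borel x"
    unfolding pos_part_def return_def space_borel
  proof (rule measure_of_eq)
    fix A :: "'a set" assume "A \<in> sigma_sets UNIV (sets borel)"
    then have A: "A \<in> sets borel" using sets.sigma_sets_eq[of "borel :: 'a measure"] by simp
    show "(SUP B\<in>{B \<in> sets borel. B \<subseteq> A}. ennreal (dirac x B)) = indicator A x"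
    proof (rule antisym)
      show "(SUP B\<in>{B \<in> sets borel. B \<subseteq> A}. ennreal (dirac x B)) \<le> indicator A x"
        by (intro SUP_least) (auto simp: dirac_def indicator_def)
      have "indicator A x = ennreal (dirac x A)" by (simp add: dirac_def indicator_def)
      also have "\<dots> \<le> (SUP B\<in>{B \<in> sets borel. B \<subseteq> A}. ennreal (dirac x B))"
        using A by (intro SUP_upper) auto
      finally show "indicator A x \<le> (SUP B\<in>{B \<in> sets borel. B \<subseteq> A}. ennreal (dirac x B))" .
    qed
  qed simp
  have "emeasure (pos_part (\<lambda>A. - dirac x A)) B = 0" for B
  proof -
    have "ennreal (- dirac x E) \<le> 0" for E by (simp add: dirac_def ennreal_neg)
    then have "(SUP E\<in>{E \<in> sets borel. E \<subseteq> B}. ennreal (- dirac x E)) \<le> 0"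
      by (intro SUP_least)
    then show ?thesis unfolding pos_part_def emeasure_measure_of_conv by simp
  qed
  then have "pos_part (\<lambda>A. - dirac x A) = null_measure borel"
    by (intro measure_eqI) auto
  then show ?thesis
    using f by (simp add: signed_integral_def pos integral_return)
qed

text \<open>
  Testing against Dirac measures. This identifies the generator at each point and makes weak limits
  unique.
\<close>

lemma wstar_lim_imp_pointwise:
  assumes "wstar_lim F f"
  shows "((\<lambda>t. F t x) \<longlongrightarrow> f x) (at_right 0)"
proof -
  have "((\<lambda>t. signed_integral (dirac x) (F t)) \<longlongrightarrow> signed_integral (dirac x) f) (at_right 0)"
    using assms finite_signed_measure_dirac by (auto simp: wstar_lim_def)
  moreover have "signed_integral (dirac x) f = f x"
    using assms by (intro signed_integral_dirac) (auto simp: wstar_lim_def bounded_borel_def)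
  moreover have "signed_integral (dirac x) (F t) = F t x" if "t > 0" for t
    using assms that by (intro signed_integral_dirac) (auto simp: wstar_lim_def bounded_borel_def)
  then have "\<forall>\<^sub>F t in at_right 0. signed_integral (dirac x) (F t) = F t x"
    by (auto simp: eventually_at_right_less intro: eventually_at_rightI[of 0 1])
  ultimately show ?thesis by (auto elim: Lim_transform_eventually)
qed

lemma wstar_lim_unique: "wstar_lim F f \<Longrightarrow> wstar_lim F g \<Longrightarrow> f = g"
  by (intro ext tendsto_unique[OF _ wstar_lim_imp_pointwise wstar_lim_imp_pointwise]) auto

lemma generator_eqI: "wstar_lim (\<lambda>t x. (H t f x - f x) / t) g \<Longrightarrow> generator H f = g"
  unfolding generator_def by (rule the_equality) (auto intro: wstar_lim_unique)


section \<open>Functions of a real variable with nonpositive right derivative\<close>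

text \<open>
  A function in the domain of the generator is only known to be differentiable from the right
  along trajectories, so the mean value theorem does not apply. Subtracting a line of small
  positive slope \<open>c\<close> makes the right derivative negative. Just beyond a point where the tilted function \<open>q\<close> is
  nonpositive it is then still nonpositive, so the last such point in \<open>[a, b]\<close> can only be \<open>b\<close>.
\<close>

lemma le_if_right_derivative_nonpos:
  fixes p :: "real \<Rightarrow> real"
  assumes "a \<le> b" and cont: "continuous_on {a..b} p"
    and der: "\<And>t. a \<le> t \<Longrightarrow> t < b \<Longrightarrow> \<exists>D\<le>0. (p has_real_derivative D) (at_right t)"
  shows "p b \<le> p a"
proof (rule field_le_epsilon)
  fix e :: real assume "e > 0"
  define c where "c = e / (b - a + 1)"
  have c: "c > 0" "c * (b - a) \<le> e"
    using \<open>a \<le> b\<close> \<open>e > 0\<close> by (auto simp: c_def field_simps)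
  define q where "q t = p t - p a - c * (t - a)" for t
  have "continuous_on {a..b} q" unfolding q_def by (intro continuous_intros cont)
  then have "closed ({a..b} \<inter> q -` {..0})"
    by (intro continuous_closed_preimage) auto
  then have "compact ({a..b} \<inter> q -` {..0})"
    using compact_Int_closed[of "{a..b}" "{a..b} \<inter> q -` {..0}"] by simp
  moreover have "a \<in> {a..b} \<inter> q -` {..0}" using \<open>a \<le> b\<close> by (simp add: q_def)
  ultimately have "\<exists>t\<in>{a..b} \<inter> q -` {..0}. \<forall>s\<in>{a..b} \<inter> q -` {..0}. s \<le> t"
    by (intro compact_attains_sup) blast+
  then obtain t where t: "t \<in> {a..b}" "q t \<le> 0"
      and sup: "\<And>s. s \<in> {a..b} \<Longrightarrow> q s \<le> 0 \<Longrightarrow> s \<le> t"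
    by auto
  have "t = b"
  proof (rule ccontr)
    assume "t \<noteq> b"
    then have "t < b" using t by simp
    then obtain D where D: "D \<le> 0" "(p has_real_derivative D) (at_right t)"
      using der[of t] t by auto
    have "(q has_real_derivative D - c) (at_right t)"
      unfolding q_def by (auto intro!: derivative_eq_intros D(2))
    then obtain d where d: "d > 0" "\<And>h. h > 0 \<Longrightarrow> h < d \<Longrightarrow> q (t + h) < q t"
      using has_real_derivative_neg_dec_right[of q "D - c" t "{t<..}"] D(1) c(1) by auto
    define h where "h = min (d / 2) (b - t)"
    have h: "h > 0" "h < d" "t + h \<le> b" using d(1) \<open>t < b\<close> by (auto simp: h_def)
    have "q (t + h) \<le> 0" using d(2)[of h] h t by simp
    with sup[of "t + h"] h t show False by simp
  qed
  with t have "q b \<le> 0" by simp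
  then show "p b \<le> p a + e" using c(2) by (simp add: q_def)
qed


section \<open>Bounded continuous functions\<close>

lemma bounded_contD:
  assumes "f \<in> bounded_cont"
  shows bounded_cont_continuous: "continuous_on UNIV f"
    and bounded_cont_bound: "\<exists>C>0. \<forall>x. \<bar>f x\<bar> \<le> C"
  using assms by (auto simp: bcontfun_def bounded_pos)

lemma bounded_contI:
  "continuous_on UNIV f \<Longrightarrow> (\<And>x. \<bar>f x\<bar> \<le> C) \<Longrightarrow> f \<in> bounded_cont"
  by (auto simp: bcontfun_def bounded_iff)

lemma bounded_cont_continuous_compose:
  "f \<in> bounded_cont \<Longrightarrow> continuous_on A g \<Longrightarrow> continuous_on A (\<lambda>x. f (g x))"
  using continuous_on_compose2[OF bounded_cont_continuous] by blast

lemma bounded_cont_diff: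
  assumes "f \<in> bounded_cont" "g \<in> bounded_cont"
  shows "(\<lambda>x. f x - g x) \<in> bounded_cont"
proof -
  obtain C D where "\<And>x. \<bar>f x\<bar> \<le> C" "\<And>x. \<bar>g x\<bar> \<le> D"
    using assms bounded_cont_bound by metis
  then have "\<bar>f x - g x\<bar> \<le> C + D" for x
    by (intro order_trans[OF abs_triangle_ineq4 add_mono])
  then show ?thesis
    by (rule bounded_contI[rotated])
       (intro continuous_on_diff bounded_cont_continuous assms)
qed

lemma bounded_cont_mult:
  assumes "f \<in> bounded_cont" "g \<in> bounded_cont"
  shows "(\<lambda>x. f x * g x) \<in> bounded_cont"
proof -
  obtain C D where "C > 0" "\<And>x. \<bar>f x\<bar> \<le> C" "\<And>x. \<bar>g x\<bar> \<le> D"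
    using assms bounded_cont_bound by metis
  then have "\<bar>f x * g x\<bar> \<le> C * D" for x
    unfolding abs_mult by (intro mult_mono) auto
  then show ?thesis
    by (rule bounded_contI[rotated])
       (intro continuous_on_mult bounded_cont_continuous assms)
qed

lemma bounded_cont_subset_bounded_borel: "f \<in> bounded_cont \<Longrightarrow> f \<in> bounded_borel"
  by (auto simp: bounded_borel_def bcontfun_def intro: borel_measurable_continuous_onI)

lemma bounded_cont_borel_measurable: "f \<in> bounded_cont \<Longrightarrow> f \<in> borel_measurable borel"
  by (intro borel_measurable_continuous_onI bounded_cont_continuous)

lemma continuous_on_prod_discrete:
  fixes g :: "'a::topological_space \<times> 'b::discrete_topology \<Rightarrow> 'c::topological_space"
  assumes "\<And>i. continuous_on UNIV (\<lambda>y. g (y, i))"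
  shows "continuous_on UNIV g"
  unfolding continuous_on_open_vimage[OF open_UNIV]
proof (intro allI impI)
  fix B :: "'c set" assume "open B"
  have "g -` B \<inter> UNIV = (\<Union>i. ((\<lambda>y. g (y, i)) -` B) \<times> {i})" by auto
  moreover have "open ((\<lambda>y. g (y, i)) -` B)" for i
    using assms[of i] \<open>open B\<close> by (auto simp: continuous_on_open_vimage)
  ultimately show "open (g -` B \<inter> UNIV)" by (auto intro!: open_Times open_discrete)
qed


section \<open>Trajectories and their survival functions\<close>

lemma has_real_derivative_integral_from_0:
  assumes "continuous_on {0..} g" "t \<ge> 0"
  shows "((\<lambda>t. integral {0..t} g) has_real_derivative g t) (at t within {0..})"
proof -
  have "((\<lambda>t. integral {0..t} g) has_real_derivative g t) (at t within {0..t + 1})"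
    using assms by (intro integral_has_real_derivative continuous_on_subset[OF assms(1)]) auto
  moreover have "at t within {0..t + 1} = at t within {0..}"
    by (rule at_within_nhd[of _ "{..<t + 1}"]) auto
  ultimately show ?thesis by simp
qed

locale modulated_semiflows =
  fixes S :: "'i::discrete_topology \<Rightarrow> real \<Rightarrow> 'y::polish_space \<Rightarrow> 'y"
    and rate :: "'y \<Rightarrow> real"
    and rate_min rate_max :: real
  assumes semiflow: "\<And>i. jointly_continuous_semiflow (S i)"
    and rate_cont: "continuous_on UNIV rate"
    and rate_min_pos: "rate_min > 0"
    and rate_bounds: "\<And>y. rate_min \<le> rate y \<and> rate y \<le> rate_max"
begin

text \<open>
  Negative times are frozen at \<open>0\<close>, so that trajectories are continuous, hence Borel, on the whole
  real line.
\<close>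

definition orbit :: "'i \<Rightarrow> 'y \<Rightarrow> real \<Rightarrow> 'y" where
  "orbit i y t = S i (max 0 t) y"

definition survival :: "'i \<Rightarrow> 'y \<Rightarrow> real \<Rightarrow> real" where
  "survival i y t = exp (- cumulative_rate S rate y i t)"

lemma rate_pos: "rate y > 0"
  using rate_min_pos rate_bounds[of y] by linarith

lemma orbit_nonneg: "t \<ge> 0 \<Longrightarrow> orbit i y t = S i t y"
  by (simp add: orbit_def)

lemma orbit_0 [simp]: "orbit i y 0 = y"
  using semiflow by (simp add: orbit_def jointly_continuous_semiflow_def)

lemma orbit_orbit: "s \<ge> 0 \<Longrightarrow> t \<ge> 0 \<Longrightarrow> orbit i (orbit i y s) t = orbit i y (s + t)"
  using semiflow[of i] by (simp add: orbit_def jointly_continuous_semiflow_def add.commute)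

lemma continuous_on_orbit [continuous_intros]:
  assumes "continuous_on A g" "continuous_on A h"
  shows "continuous_on A (\<lambda>x. orbit i (g x) (h x))"
proof -
  have "continuous_on ({0..} \<times> UNIV) (\<lambda>(t, y). S i t y)"
    using semiflow[of i] by (simp add: jointly_continuous_semiflow_def)
  then have "continuous_on A (\<lambda>x. (\<lambda>(t, y). S i t y) (max 0 (h x), g x))"
    by (rule continuous_on_compose2) (auto intro!: continuous_intros assms)
  then show ?thesis by (simp add: orbit_def)
qed

lemma continuous_on_rate [continuous_intros]:
  "continuous_on A g \<Longrightarrow> continuous_on A (\<lambda>x. rate (g x))"
  using continuous_on_compose2[OF rate_cont] by blast

lemma cumulative_rate_eq_integral:
  "cumulative_rate S rate y i t = integral {0..t} (\<lambda>h. rate (orbit i y h))"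
proof -
  have "cumulative_rate S rate y i t = (LBINT h:{0..t}. rate (orbit i y h))"
    unfolding cumulative_rate_def by (intro set_lebesgue_integral_cong) (auto simp: orbit_nonneg)
  also have "\<dots> = integral {0..t} (\<lambda>h. rate (orbit i y h))"
    by (intro set_borel_integral_eq_integral(2) borel_integrable_atLeastAtMost' continuous_intros)
  finally show ?thesis .
qed

lemma survival_0 [simp]: "survival i y 0 = 1"
  by (simp add: survival_def cumulative_rate_eq_integral)

lemma survival_pos: "survival i y t > 0"
  by (simp add: survival_def)

lemma survival_le:
  assumes "t \<ge> 0"
  shows "survival i y t \<le> exp (- (rate_min * t))"
proof -
  have "integral {0..t} (\<lambda>_. rate_min) \<le> integral {0..t} (\<lambda>h. rate (orbit i y h))"
    using rate_bounds
    by (intro integral_le integrable_continuous_interval continuous_intros) auto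
  then show ?thesis
    using assms by (simp add: survival_def cumulative_rate_eq_integral mult.commute)
qed

text \<open>
  The multiplicative form of the cocycle identity for the cumulative rate: surviving for \<open>s + t\<close>
  means surviving for \<open>s\<close> and then for \<open>t\<close> from the point reached.
\<close>

lemma survival_orbit:
  assumes "s \<ge> 0" "t \<ge> 0"
  shows "survival i (orbit i y s) t = survival i y (s + t) / survival i y s"
proof -
  let ?r = "\<lambda>h. rate (orbit i y h)"
  have "integral {0..t} (\<lambda>h. rate (orbit i (orbit i y s) h)) = integral {0..t} (?r \<circ> (\<lambda>h. h + s))"
    using assms by (intro integral_cong) (auto simp: orbit_orbit add.commute)
  also have "\<dots> = integral {s..s + t} ?r"
    by (subst integral_shift) (auto intro!: continuous_intros simp: add.commute)
  finally have "integral {0..t} (\<lambda>h. rate (orbit i (orbit i y s) h)) = integral {s..s + t} ?r" .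
  moreover have "integral {0..s} ?r + integral {s..s + t} ?r = integral {0..s + t} ?r"
    using assms
    by (intro Henstock_Kurzweil_Integration.integral_combine integrable_continuous_interval
        continuous_intros) auto
  ultimately show ?thesis
    by (simp add: survival_def cumulative_rate_eq_integral flip: exp_diff)
qed

lemma has_real_derivative_survival:
  assumes "t \<ge> 0"
  shows "(survival i y has_real_derivative - rate (orbit i y t) * survival i y t)
           (at t within {0..})"
proof -
  have "((\<lambda>t. exp (- integral {0..t} (\<lambda>h. rate (orbit i y h)))) has_real_derivative
      - rate (orbit i y t) * exp (- integral {0..t} (\<lambda>h. rate (orbit i y h)))) (at t within {0..})"
    using assms
    by (auto intro!: derivative_eq_intros has_real_derivative_integral_from_0 continuous_intros)
  then show ?thesis by (simp add: survival_def[abs_def] cumulative_rate_eq_integral)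
qed

lemma continuous_on_survival: "continuous_on {0..} (survival i y)"
  using has_real_derivative_survival by (intro DERIV_continuous_on) auto

lemma continuous_on_survival_start: "continuous_on UNIV (\<lambda>y. survival i y t)"
proof -
  have "continuous_on UNIV (\<lambda>y. integral (cbox 0 t) (\<lambda>h. rate (orbit i y h)))"
    by (intro integral_continuous_on_param)
       (auto simp: case_prod_beta intro!: continuous_intros)
  then show ?thesis
    unfolding survival_def cumulative_rate_eq_integral by (intro continuous_intros) auto
qed

lemma set_integrable_exp_decay: "set_integrable lborel {0..} (\<lambda>t. exp (- (rate_min * t)))"
proof -
  have "(\<lambda>t. exp (- rate_min * t)) absolutely_integrable_on {0..}"
    using integrable_on_exp_minus_to_infinity[OF rate_min_pos]
    by (intro nonnegative_absolutely_integrable_1) auto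
  then show ?thesis by (simp add: set_integrable_def integrable_completion)
qed

lemma set_borel_measurable_survival_mult:
  assumes "continuous_on {0..} k"
  shows "set_borel_measurable lborel {0..} (\<lambda>t. survival i y t * k t)"
  using set_measurable_continuous_on[of "{0..}" "\<lambda>t. survival i y t * k t"]
    continuous_on_mult[OF continuous_on_survival assms]
  by (simp add: set_borel_measurable_def)

lemma survival_mult_le:
  assumes "t \<ge> 0" "\<bar>k\<bar> \<le> C"
  shows "\<bar>survival i y t * k\<bar> \<le> C * exp (- (rate_min * t))"
proof -
  have "\<bar>survival i y t * k\<bar> = survival i y t * \<bar>k\<bar>"
    using survival_pos[of i y t] by (simp add: abs_mult)
  also have "\<dots> \<le> exp (- (rate_min * t)) * C"
    using assms survival_le by (intro mult_mono) auto
  finally show ?thesis by (simp add: mult.commute)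
qed

lemma set_integrable_survival_mult:
  assumes "continuous_on {0..} k" "\<And>t. t \<ge> 0 \<Longrightarrow> \<bar>k t\<bar> \<le> C"
  shows "set_integrable lborel {0..} (\<lambda>t. survival i y t * k t)"
proof (rule set_integrable_bound)
  show "set_integrable lborel {0..} (\<lambda>t. C * exp (- (rate_min * t)))"
    using set_integrable_exp_decay by simp
  show "AE t in lborel. t \<in> {0..} \<longrightarrow>
      norm (survival i y t * k t) \<le> norm (C * exp (- (rate_min * t)))"
  proof (intro AE_I2 impI)
    fix t :: real assume "t \<in> {0..}"
    then have "\<bar>survival i y t * k t\<bar> \<le> C * exp (- (rate_min * t))"
      using assms(2)[of t] by (intro survival_mult_le) auto
    then show "norm (survival i y t * k t) \<le> norm (C * exp (- (rate_min * t)))"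
      unfolding real_norm_def by linarith
  qed
qed (rule set_borel_measurable_survival_mult[OF assms(1)])


section \<open>The kernel as an integral along trajectories\<close>

text \<open>
  The kernel is the law of the trajectory at a random time whose density is rate times survival
  function; integration against it is a change of variables.
\<close>

lemma G_op_eq:
  assumes f: "f \<in> borel_measurable borel"
  shows "G_op S rate f (y, i) =
    (LBINT t:{0..}. survival i y t * (rate (orbit i y t) * f (orbit i y t, i)))"
proof -
  define d where "d t = indicator {0..} t *\<^sub>R (survival i y t * rate (orbit i y t))" for t
  have d_borel: "d \<in> borel_measurable borel"
    unfolding d_def
    by (intro borel_measurable_continuous_on_indicator continuous_intros continuous_on_survival) auto
  have d_nonneg: "d t \<ge> 0" for t
    using survival_pos[of i y t] rate_pos[of "orbit i y t"] by (simp add: d_def indicator_def)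
  have orbit_borel: "(\<lambda>t. (orbit i y t, i)) \<in> borel_measurable borel"
    by (intro borel_measurable_continuous_onI continuous_intros)
  let ?M = "density lborel (\<lambda>t. ennreal (d t))"
  have "G_kernel S rate (y, i) = distr ?M borel (\<lambda>t. (orbit i y t, i))"
    unfolding G_kernel_def prod.case distr_def space_borel
  proof (rule measure_of_eq)
    fix A :: "('y \<times> 'i) set" assume "A \<in> sigma_sets UNIV (sets borel)"
    then have A: "A \<in> sets borel"
      using sets.sigma_sets_eq[of "borel :: ('y \<times> 'i) measure"] by simp
    then have "(\<lambda>t. (orbit i y t, i)) -` A \<in> sets borel"
      using measurable_sets[OF orbit_borel A] by simp
    then have "emeasure ?M ((\<lambda>t. (orbit i y t, i)) -` A) =
        (\<integral>\<^sup>+t. ennreal (d t) * indicator ((\<lambda>t. (orbit i y t, i)) -` A) t \<partial>lborel)"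
      using d_borel by (subst emeasure_density) auto
    also have "\<dots> = (\<integral>\<^sup>+t\<in>{0..}. (ennreal (rate (S i t y) * exp (- cumulative_rate S rate y i t))
        * indicator A (S i t y, i)) \<partial>lborel)"
      by (intro nn_integral_cong)
         (auto simp: d_def indicator_def orbit_nonneg survival_def mult.commute)
    finally show "(\<integral>\<^sup>+t\<in>{0..}. (ennreal (rate (S i t y) * exp (- cumulative_rate S rate y i t))
        * indicator A (S i t y, i)) \<partial>lborel) =
        emeasure ?M ((\<lambda>t. (orbit i y t, i)) -` A \<inter> space ?M)" by simp
  qed auto
  then have "G_op S rate f (y, i) = (\<integral>x. f x \<partial>distr ?M borel (\<lambda>t. (orbit i y t, i)))"
    by (simp add: G_op_def kernel_op_def)
  also have "\<dots> = (\<integral>t. f (orbit i y t, i) \<partial>?M)"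
    using f orbit_borel by (intro integral_distr) auto
  also have "\<dots> = (\<integral>t. d t *\<^sub>R f (orbit i y t, i) \<partial>lborel)"
    using d_borel d_nonneg measurable_compose[OF orbit_borel f] by (intro integral_density) auto
  finally show ?thesis
    by (simp add: set_lebesgue_integral_def d_def mult.assoc)
qed

text \<open>
  For a fixed discrete component, dominated convergence gives sequential continuity in the starting
  point. The majorant \<open>w\<close> does not depend on the starting point, since the rate is bounded below;
  its integral also bounds the image.
\<close>

lemma G_op_bounded_cont:
  assumes f: "f \<in> bounded_cont"
  shows "G_op S rate f \<in> bounded_cont"
proof -
  obtain C where C: "C > 0" "\<And>x. \<bar>f x\<bar> \<le> C" using bounded_cont_bound[OF f] by blast
  define k where "k i y t = rate (orbit i y t) * f (orbit i y t, i)" for i y t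
  have k_cont: "continuous_on A (\<lambda>x. k i (g x) (h x))"
    if "continuous_on A g" "continuous_on A h" for A i and g :: "'z::topological_space \<Rightarrow> 'y" and h
    unfolding k_def
    by (intro continuous_intros bounded_cont_continuous_compose[OF f] that)
  have k_le: "\<bar>k i y t\<bar> \<le> rate_max * C" for i y t
    unfolding k_def abs_mult
    using C rate_bounds[of "orbit i y t"] rate_pos[of "orbit i y t"] by (intro mult_mono) auto
  have G: "G_op S rate f (y, i) = (LBINT t:{0..}. survival i y t * k i y t)" for y i
    unfolding k_def by (rule G_op_eq[OF bounded_cont_borel_measurable[OF f]])
  define w where "w t = indicator {0..} t *\<^sub>R (rate_max * C * exp (- (rate_min * t)))" for t
  have w: "integrable lborel w"
    using set_integrable_mult_right[of "rate_max * C", OF set_integrable_exp_decay]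
    unfolding w_def set_integrable_def by simp
  have w_ge: "norm (indicator {0..} t *\<^sub>R (survival i y t * k i y t)) \<le> w t" for i y t
    using survival_mult_le[OF _ k_le[of i y t], of t i y]
    by (auto simp: w_def indicator_def)
  have k_int: "integrable lborel (\<lambda>t. indicator {0..} t *\<^sub>R (survival i y t * k i y t))" for i y
    unfolding set_integrable_def[symmetric]
    by (rule set_integrable_survival_mult[OF _ k_le])
       (intro k_cont continuous_intros)
  show ?thesis
  proof (rule bounded_contI)
    fix x
    show "\<bar>G_op S rate f x\<bar> \<le> (\<integral>t. w t \<partial>lborel)"
      using Bochner_Integration.integral_norm_bound_integral[OF k_int w w_ge]
      by (cases x) (simp add: G set_lebesgue_integral_def)
  next
    show "continuous_on UNIV (G_op S rate f)"
    proof (rule continuous_on_prod_discrete)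
      fix i
      show "continuous_on UNIV (\<lambda>y. G_op S rate f (y, i))"
        unfolding continuous_on_sequentially
      proof (intro allI ballI impI)
        fix u :: "nat \<Rightarrow> 'y" and y
        assume "(\<forall>n. u n \<in> UNIV) \<and> u \<longlonglongrightarrow> y"
        then have u: "u \<longlonglongrightarrow> y" by simp
        show "((\<lambda>y. G_op S rate f (y, i)) \<circ> u) \<longlonglongrightarrow> G_op S rate f (y, i)"
          unfolding comp_def G set_lebesgue_integral_def
        proof (rule integral_dominated_convergence[OF _ _ w])
          show "AE t in lborel. (\<lambda>n. indicator {0..} t *\<^sub>R (survival i (u n) t * k i (u n) t))
              \<longlonglongrightarrow> indicator {0..} t *\<^sub>R (survival i y t * k i y t)"
          proof (rule AE_I2)
            fix t :: real
            have "continuous_on UNIV (\<lambda>y. survival i y t * k i y t)"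
              by (intro continuous_on_mult continuous_on_survival_start k_cont continuous_intros)
            then have "(\<lambda>n. survival i (u n) t * k i (u n) t) \<longlonglongrightarrow> survival i y t * k i y t"
              by (rule continuous_on_tendsto_compose) (use u in auto)
            then show "(\<lambda>n. indicator {0..} t *\<^sub>R (survival i (u n) t * k i (u n) t))
              \<longlonglongrightarrow> indicator {0..} t *\<^sub>R (survival i y t * k i y t)"
              by (intro tendsto_scaleR tendsto_const)
          qed
        qed (rule borel_measurable_integrable[OF k_int] AE_I2[OF w_ge])+
      qed
    qed
  qed
qed

lemma set_integrable_G_op:
  assumes f: "f \<in> bounded_cont"
  shows "set_integrable lborel {0..} (\<lambda>t. survival i y t * (rate (orbit i y t) * f (orbit i y t, i)))"
proof -
  obtain C where C: "C > 0" "\<And>x. \<bar>f x\<bar> \<le> C" using bounded_cont_bound[OF f] by blast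
  show ?thesis
  proof (rule set_integrable_survival_mult)
    show "continuous_on {0..} (\<lambda>t. rate (orbit i y t) * f (orbit i y t, i))"
      by (intro continuous_intros bounded_cont_continuous_compose[OF f])
    show "\<bar>rate (orbit i y t) * f (orbit i y t, i)\<bar> \<le> rate_max * C" for t
      unfolding abs_mult
      using C rate_bounds[of "orbit i y t"] rate_pos[of "orbit i y t"] by (intro mult_mono) auto
  qed
qed

lemma G_op_diff:
  assumes f: "f \<in> bounded_cont" and g: "g \<in> bounded_cont"
  shows "G_op S rate (\<lambda>x. f x - g x) x = G_op S rate f x - G_op S rate g x"
proof -
  obtain y i where x: "x = (y, i)" by (cases x)
  let ?k = "\<lambda>f t. survival i y t * (rate (orbit i y t) * f (orbit i y t, i))"
  have "G_op S rate (\<lambda>x. f x - g x) x = (LBINT t:{0..}. ?k f t - ?k g t)"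
    unfolding x G_op_eq[OF bounded_cont_borel_measurable[OF bounded_cont_diff[OF f g]]]
    by (simp only: right_diff_distrib)
  also have "\<dots> = (LBINT t:{0..}. ?k f t) - (LBINT t:{0..}. ?k g t)"
    by (rule set_integral_diff(2)[OF set_integrable_G_op[OF f] set_integrable_G_op[OF g]])
  finally show ?thesis
    unfolding x G_op_eq[OF bounded_cont_borel_measurable[OF f]]
      G_op_eq[OF bounded_cont_borel_measurable[OF g]] .
qed


section \<open>The range of the kernel lies in the domain of the generator\<close>

lemma rate_hat_bounded_cont: "(rate_hat rate :: 'y \<times> 'i \<Rightarrow> real) \<in> bounded_cont"
proof (rule bounded_contI)
  show "continuous_on UNIV (rate_hat rate :: 'y \<times> 'i \<Rightarrow> real)"
    unfolding rate_hat_def case_prod_beta by (intro continuous_intros)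
  show "\<bar>rate_hat rate x\<bar> \<le> rate_max" for x :: "'y \<times> 'i"
    using rate_bounds[of "fst x"] rate_pos[of "fst x"] by (simp add: rate_hat_def case_prod_beta)
qed

lemma inverse_rate_hat_bounded_cont: "(\<lambda>x :: 'y \<times> 'i. 1 / rate_hat rate x) \<in> bounded_cont"
proof (rule bounded_contI)
  show "continuous_on UNIV (\<lambda>x :: 'y \<times> 'i. 1 / rate_hat rate x)"
    unfolding rate_hat_def case_prod_beta
    using rate_pos less_imp_neq by (intro continuous_intros) fastforce
  show "\<bar>1 / rate_hat rate x\<bar> \<le> 1 / rate_min" for x :: "'y \<times> 'i"
    using rate_bounds[of "fst x"] rate_pos[of "fst x"] rate_min_pos
    by (simp add: rate_hat_def case_prod_beta frac_le)
qed

lemma transport_orbit: "t \<ge> 0 \<Longrightarrow> transport S t f (y, i) = f (orbit i y t, i)"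
  by (simp add: transport_def orbit_nonneg)

lemma transport_bounded_cont:
  assumes f: "f \<in> bounded_cont" and "t \<ge> 0"
  shows "transport S t f \<in> bounded_cont"
proof -
  obtain C where C: "\<And>x. \<bar>f x\<bar> \<le> C" using bounded_cont_bound[OF f] by blast
  show ?thesis
  proof (rule bounded_contI[of _ C])
    show "continuous_on UNIV (transport S t f)"
      using \<open>t \<ge> 0\<close>
      by (intro continuous_on_prod_discrete)
         (simp add: transport_orbit bounded_cont_continuous_compose[OF f] continuous_intros)
    show "\<bar>transport S t f x\<bar> \<le> C" for x using C by (cases x) (simp add: transport_def)
  qed
qed

text \<open>
  Weak convergence as defined requires the approximating functions to be bounded and Borel.
\<close>

lemma difference_quotient_bounded_borel:
  assumes f: "f \<in> bounded_cont" and "t > 0"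
  shows "(\<lambda>x. (transport S t f x - f x) / t) \<in> bounded_borel"
proof -
  have "(\<lambda>_. 1 / t) \<in> bounded_cont" by (intro bounded_contI[of _ "\<bar>1 / t\<bar>"]) auto
  from bounded_cont_mult[OF bounded_cont_diff[OF transport_bounded_cont[OF f] f] this] \<open>t > 0\<close>
  show ?thesis by (intro bounded_cont_subset_bounded_borel) simp
qed

text \<open>
  Trajectories are continuous and transport does not increase the supremum norm, so
  bounded pointwise convergence holds at time \<open>0\<close>.
\<close>

lemma weak_continuity_space_transport:
  "weak_continuity_space bounded_cont (transport S) = bounded_cont"
proof -
  have "wstar_lim (\<lambda>t. transport S t f) f" if f: "f \<in> bounded_cont" for f
  proof -
    obtain C where C: "\<And>x. \<bar>f x\<bar> \<le> C" using bounded_cont_bound[OF f] by blast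
    show ?thesis
    proof (rule wstar_lim_if_bounded_pointwise)
      show "\<bar>transport S t f x\<bar> \<le> C" for t x using C by (cases x) (simp add: transport_def)
      show "((\<lambda>t. transport S t f x) \<longlongrightarrow> f x) (at_right 0)" for x
      proof -
        obtain y i where x: "x = (y, i)" by (cases x)
        have "continuous_on UNIV (\<lambda>t. f (orbit i y t, i))"
          by (intro bounded_cont_continuous_compose[OF f] continuous_intros)
        then have "((\<lambda>t. f (orbit i y t, i)) \<longlongrightarrow> f (orbit i y 0, i)) (at 0)"
          unfolding continuous_on_def by blast
        then have "((\<lambda>t. f (orbit i y t, i)) \<longlongrightarrow> f x) (at_right 0)"
          by (auto simp: x intro: tendsto_mono[OF at_le])
        then show ?thesis
          by (rule Lim_transform_eventually)
             (auto simp: x transport_orbit intro: eventually_at_rightI[of 0 1])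
      qed
      show "transport S t f \<in> bounded_borel" if "t > 0" for t
        by (intro bounded_cont_subset_bounded_borel transport_bounded_cont f less_imp_le that)
    qed (rule bounded_cont_subset_bounded_borel[OF f])
  qed
  then show ?thesis by (auto simp: weak_continuity_space_def)
qed

lemma Q_domain_iff:
  "f \<in> Q_domain S \<longleftrightarrow> f \<in> bounded_cont \<and>
    (\<exists>g\<in>bounded_cont. wstar_lim (\<lambda>t x. (transport S t f x - f x) / t) g)"
  by (auto simp: Q_domain_def generator_domain_def weak_continuity_space_transport)

text \<open>
  By the cocycle identity, starting at the point reached at time \<open>s\<close> means deleting the times up
  to \<open>s\<close> from the integral and renormalising by the survival probability. This makes the image
  of the kernel explicit, and hence differentiable, along each trajectory.
\<close>

lemma G_op_orbit:
  assumes f: "f \<in> bounded_cont" and "s \<ge> 0"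
  shows "G_op S rate f (orbit i y s, i) =
    (G_op S rate f (y, i)
      - integral {0..s} (\<lambda>t. survival i y t * (rate (orbit i y t) * f (orbit i y t, i))))
    / survival i y s"
proof -
  let ?w = "\<lambda>t. survival i y t * (rate (orbit i y t) * f (orbit i y t, i))"
  have f_borel: "f \<in> borel_measurable borel"
    by (rule bounded_cont_borel_measurable[OF f])
  have int: "set_integrable lborel {0..} ?w" by (rule set_integrable_G_op[OF f])
  have "G_op S rate f (orbit i y s, i) = (LBINT t:{0..}. ?w (s + t) / survival i y s)"
    unfolding G_op_eq[OF f_borel]
    by (intro set_lebesgue_integral_cong) (auto simp: survival_orbit orbit_orbit \<open>s \<ge> 0\<close>)
  also have "\<dots> = (LBINT t:{0..}. ?w (s + t)) / survival i y s" by simp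
  also have "(LBINT t:{0..}. ?w (s + t)) = (LBINT t:{s..}. ?w t)"
    unfolding set_lebesgue_integral_def
    by (subst (2) lborel_integral_real_affine[of 1 _ s]) (simp_all add: indicator_def)
  also have "(LBINT t:{s..}. ?w t) = G_op S rate f (y, i) - integral {0..s} ?w"
  proof -
    have "set_integrable lborel {s..} ?w" "set_integrable lborel {0..s} ?w"
      using \<open>s \<ge> 0\<close> by (auto intro!: set_integrable_subset[OF int])
    note ints = set_borel_integral_eq_integral[OF this(1)] set_borel_integral_eq_integral[OF this(2)]
    have "{0..s} \<inter> {s..} = {s}" "{0..s} \<union> {s..} = {0..}" using \<open>s \<ge> 0\<close> by auto
    with integral_Un[OF ints(3) ints(1)] have "integral {0..} ?w = integral {0..s} ?w + integral {s..} ?w"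
      by simp
    then show ?thesis
      by (simp add: G_op_eq[OF f_borel] ints(2) set_borel_integral_eq_integral(2)[OF int])
  qed
  finally show ?thesis .
qed

lemma has_real_derivative_G_op_orbit:
  assumes f: "f \<in> bounded_cont" and "s \<ge> 0"
  shows "((\<lambda>s. G_op S rate f (orbit i y s, i)) has_real_derivative
    rate (orbit i y s) * (G_op S rate f (orbit i y s, i) - f (orbit i y s, i))) (at s within {0..})"
proof -
  let ?w = "\<lambda>t. survival i y t * (rate (orbit i y t) * f (orbit i y t, i))"
  let ?a = "G_op S rate f (y, i)"
  have "continuous_on {0..} ?w"
    by (intro continuous_intros continuous_on_survival bounded_cont_continuous_compose[OF f])
  note W = has_real_derivative_integral_from_0[OF this \<open>s \<ge> 0\<close>]
  have nz: "survival i y s \<noteq> 0" using survival_pos[of i y s] by simp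
  have "((\<lambda>s. (?a - integral {0..s} ?w) / survival i y s) has_real_derivative
      ((0 - ?w s) * survival i y s
        - (?a - integral {0..s} ?w) * (- rate (orbit i y s) * survival i y s))
      / (survival i y s * survival i y s)) (at s within {0..})"
    by (intro DERIV_divide DERIV_diff DERIV_const W has_real_derivative_survival nz \<open>s \<ge> 0\<close>)
  moreover have "((0 - ?w s) * survival i y s
        - (?a - integral {0..s} ?w) * (- rate (orbit i y s) * survival i y s))
      / (survival i y s * survival i y s) =
      rate (orbit i y s) * (G_op S rate f (orbit i y s, i) - f (orbit i y s, i))"
    unfolding G_op_orbit[OF f \<open>s \<ge> 0\<close>] using nz by (simp add: field_simps)
  ultimately have "((\<lambda>s. (?a - integral {0..s} ?w) / survival i y s) has_real_derivative
      rate (orbit i y s) * (G_op S rate f (orbit i y s, i) - f (orbit i y s, i))) (at s within {0..})"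
    by simp
  then show ?thesis
    by (rule has_field_derivative_transform_within[OF _ zero_less_one])
       (use \<open>s \<ge> 0\<close> G_op_orbit[OF f] in auto)
qed

text \<open>
  The derivative along trajectories gives the pointwise limit at time \<open>0\<close>. Its values at later times
  are bounded as well, so the mean value inequality bounds the difference quotients uniformly.
\<close>

lemma wstar_lim_G_op:
  assumes f: "f \<in> bounded_cont"
  defines "g \<equiv> G_op S rate f"
  shows "wstar_lim (\<lambda>t x. (transport S t g x - g x) / t) (\<lambda>x. rate_hat rate x * (g x - f x))"
proof -
  have g: "g \<in> bounded_cont" unfolding g_def by (rule G_op_bounded_cont[OF f])
  have h: "(\<lambda>x. rate_hat rate x * (g x - f x)) \<in> bounded_cont"
    by (intro bounded_cont_mult rate_hat_bounded_cont bounded_cont_diff f g)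
  then obtain C where C: "\<And>x. \<bar>rate_hat rate x * (g x - f x)\<bar> \<le> C"
    using bounded_cont_bound[OF h] by blast
  have der: "((\<lambda>s. g (orbit i y s, i)) has_real_derivative
      rate_hat rate (orbit i y s, i) * (g (orbit i y s, i) - f (orbit i y s, i))) (at s within {0..})"
    if "s \<ge> 0" for i y s
    using has_real_derivative_G_op_orbit[OF f that] by (simp add: g_def rate_hat_def)
  show ?thesis
  proof (rule wstar_lim_if_bounded_pointwise)
    show "\<bar>(transport S t g x - g x) / t\<bar> \<le> C" if "t > 0" for t x
    proof -
      obtain y i where x: "x = (y, i)" by (cases x)
      have "norm (g (orbit i y t, i) - g (orbit i y 0, i)) \<le> C * norm (t - 0)"
        by (rule field_differentiable_bound[OF convex_real_interval(1) der])
           (use C that in auto)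
      then show ?thesis
        using that by (simp add: x transport_orbit divide_le_eq)
    qed
    show "((\<lambda>t. (transport S t g x - g x) / t) \<longlongrightarrow> rate_hat rate x * (g x - f x)) (at_right 0)" for x
    proof -
      obtain y i where x: "x = (y, i)" by (cases x)
      have "((\<lambda>s. g (orbit i y s, i)) has_real_derivative rate_hat rate x * (g x - f x)) (at_right 0)"
        using der[of 0 i y] by (auto simp: x intro: DERIV_subset)
      then have "((\<lambda>t. (g (orbit i y t, i) - g x) / t) \<longlongrightarrow> rate_hat rate x * (g x - f x)) (at_right 0)"
        by (simp add: x has_field_derivative_iff)
      then show ?thesis
        by (rule Lim_transform_eventually)
           (auto simp: x transport_orbit intro: eventually_at_rightI[of 0 1])
    qed
  qed (auto intro: difference_quotient_bounded_borel[OF g] bounded_cont_subset_bounded_borel[OF h])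
qed

lemma G_op_in_Q_domain:
  assumes f: "f \<in> bounded_cont"
  shows "G_op S rate f \<in> Q_domain S"
proof -
  have "(\<lambda>x. rate_hat rate x * (G_op S rate f x - f x)) \<in> bounded_cont"
    by (intro bounded_cont_mult rate_hat_bounded_cont bounded_cont_diff G_op_bounded_cont f)
  then show ?thesis
    using wstar_lim_G_op[OF f] G_op_bounded_cont[OF f] unfolding Q_domain_iff by blast
qed

lemma G_op_right_inverse:
  assumes f: "f \<in> bounded_cont"
  shows "G_op S rate f x - scaled_generator S rate (G_op S rate f) x = f x"
proof -
  have "Q_generator S (G_op S rate f) x = rate_hat rate x * (G_op S rate f x - f x)"
    unfolding Q_generator_def using generator_eqI[of "transport S" "G_op S rate f", OF wstar_lim_G_op[OF f]] by simp
  moreover have "rate_hat rate x \<noteq> 0"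
    using rate_pos[of "fst x"] by (simp add: rate_hat_def case_prod_beta)
  ultimately show ?thesis by (simp add: scaled_generator_def)
qed


section \<open>The kernel inverts the generator on its domain\<close>

lemma wstar_lim_Q_generator:
  assumes "f \<in> Q_domain S"
  shows "wstar_lim (\<lambda>t x. (transport S t f x - f x) / t) (Q_generator S f)"
    and "Q_generator S f \<in> bounded_cont"
  using assms generator_eqI[of "transport S" f] by (auto simp: Q_domain_iff Q_generator_def)

lemma scaled_generator_bounded_cont:
  assumes "f \<in> Q_domain S"
  shows "scaled_generator S rate f \<in> bounded_cont"
  using bounded_cont_mult[OF wstar_lim_Q_generator(2)[OF assms] inverse_rate_hat_bounded_cont]
  by (simp add: scaled_generator_def)

lemma has_right_derivative_along_orbit:
  assumes f: "f \<in> Q_domain S" and "s \<ge> 0"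
  shows "((\<lambda>t. f (orbit i y t, i)) has_real_derivative Q_generator S f (orbit i y s, i)) (at_right s)"
proof -
  let ?x = "(orbit i y s, i)"
  have "((\<lambda>t. (transport S t f ?x - f ?x) / t) \<longlongrightarrow> Q_generator S f ?x) (at_right 0)"
    by (rule wstar_lim_imp_pointwise[OF wstar_lim_Q_generator(1)[OF f]])
  then have "((\<lambda>t. (f (orbit i y (t + s), i) - f ?x) / (t + s - s)) \<longlongrightarrow> Q_generator S f ?x) (at_right 0)"
    by (rule Lim_transform_eventually)
       (auto simp: transport_orbit orbit_orbit add.commute \<open>s \<ge> 0\<close> intro: eventually_at_rightI[of 0 1])
  then have "((\<lambda>t. (f (orbit i y t, i) - f ?x) / (t - s)) \<longlongrightarrow> Q_generator S f ?x) (at_right s)"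
    unfolding filterlim_at_right_to_0[of _ _ s] .
  then show ?thesis unfolding has_field_derivative_iff .
qed

text \<open>
  With \<open>\<phi>\<close>, \<open>h\<close> denoting \<open>f\<close> and its generator along a trajectory, \<open>r\<close> the rate and \<open>E\<close> the survival
  function, \<open>E \<phi> + \<integral> E (r \<phi> - h)\<close> has right derivative \<open>0\<close>, so it is constantly its
  initial value. As time tends to infinity the first term vanishes and the second becomes the
  kernel applied to \<open>f - h / r\<close>.
\<close>

lemma G_op_left_inverse:
  assumes f: "f \<in> Q_domain S"
  shows "G_op S rate f x - G_op S rate (scaled_generator S rate f) x = f x"
proof -
  obtain y i where x: "x = (y, i)" by (cases x)
  define h where "h = Q_generator S f"
  have f_cont: "f \<in> bounded_cont" using f by (simp add: Q_domain_iff)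
  have g_cont: "scaled_generator S rate f \<in> bounded_cont" by (rule scaled_generator_bounded_cont[OF f])
  define v where "v t = survival i y t * (rate (orbit i y t) *
      (f (orbit i y t, i) - scaled_generator S rate f (orbit i y t, i)))" for t
  have d_cont: "(\<lambda>x. f x - scaled_generator S rate f x) \<in> bounded_cont"
    by (rule bounded_cont_diff[OF f_cont g_cont])
  have v_cont: "continuous_on {0..} v"
    unfolding v_def
    by (intro continuous_on_mult continuous_intros continuous_on_survival
        bounded_cont_continuous_compose[OF d_cont])
  have v_int: "set_integrable lborel {0..} v"
    unfolding v_def by (rule set_integrable_G_op[OF d_cont])
  have v_eq: "v t = survival i y t *
      (rate (orbit i y t) * f (orbit i y t, i) - h (orbit i y t, i))" for t
    using rate_pos[of "orbit i y t"]
    by (simp add: v_def h_def scaled_generator_def rate_hat_def right_diff_distrib)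
  define p where "p t = survival i y t * f (orbit i y t, i) + integral {0..t} v" for t
  have p_cont: "continuous_on {0..} p"
  proof -
    have "continuous_on {0..} (\<lambda>t. integral {0..t} v)"
      using has_real_derivative_integral_from_0[OF v_cont] by (intro DERIV_continuous_on) auto
    then show ?thesis
      unfolding p_def
      by (intro continuous_intros continuous_on_survival bounded_cont_continuous_compose[OF f_cont])
  qed
  have p_der: "(p has_real_derivative 0) (at_right t)" if "t \<ge> 0" for t
  proof -
    have sub: "{t<..} \<subseteq> {0..}" using that by auto
    have "((\<lambda>t. survival i y t * f (orbit i y t, i) + integral {0..t} v) has_real_derivative
        (- rate (orbit i y t) * survival i y t) * f (orbit i y t, i)
          + h (orbit i y t, i) * survival i y t + v t) (at_right t)"
      unfolding h_def
      by (intro DERIV_add DERIV_mult has_right_derivative_along_orbit[OF f that]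
          DERIV_subset[OF has_real_derivative_survival sub]
          DERIV_subset[OF has_real_derivative_integral_from_0[OF v_cont] sub] that)
    then show ?thesis unfolding p_def by (simp add: v_eq algebra_simps)
  qed
  have p_const: "p T = f x" if "T \<ge> 0" for T
  proof -
    have cont: "continuous_on {0..T} p" by (rule continuous_on_subset[OF p_cont]) auto
    have "p T \<le> p 0"
      by (rule le_if_right_derivative_nonpos[OF that cont]) (use p_der in blast)
    moreover have "- p T \<le> - p 0"
      by (rule le_if_right_derivative_nonpos[OF that continuous_on_minus[OF cont]])
         (use DERIV_minus[OF p_der] in force)
    ultimately show ?thesis by (simp add: p_def x)
  qed
  have "(p \<longlongrightarrow> 0 + (LBINT t:{0..}. v t)) at_top"
    unfolding p_def
  proof (rule tendsto_add)
    obtain C where C: "\<And>x. \<bar>f x\<bar> \<le> C" using bounded_cont_bound[OF f_cont] by blast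
    have "((\<lambda>t. C * exp (- (rate_min * t))) \<longlongrightarrow> 0) at_top"
      using rate_min_pos by real_asymp
    moreover have "\<forall>\<^sub>F t in at_top. norm (survival i y t * f (orbit i y t, i)) \<le> C * exp (- (rate_min * t))"
      using eventually_ge_at_top[of 0] by eventually_elim (simp only: real_norm_def survival_mult_le C)
    ultimately show "((\<lambda>t. survival i y t * f (orbit i y t, i)) \<longlongrightarrow> 0) at_top"
      by (rule Lim_null_comparison[rotated])
    have "((\<lambda>t. LBINT u:{0..t}. v u) \<longlongrightarrow> (LBINT t:{0..}. v t)) at_top"
      by (rule tendsto_set_lebesgue_integral_at_top[OF _ v_int]) auto
    moreover have "(LBINT u:{0..t}. v u) = integral {0..t} v" for t
      by (intro set_borel_integral_eq_integral(2) set_integrable_subset[OF v_int]) auto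
    ultimately show "((\<lambda>t. integral {0..t} v) \<longlongrightarrow> (LBINT t:{0..}. v t)) at_top" by simp
  qed
  moreover have "(p \<longlongrightarrow> f x) at_top"
    by (rule tendsto_eventually[OF eventually_mono[OF eventually_ge_at_top p_const]])
  ultimately have "(LBINT t:{0..}. v t) = f x"
    using tendsto_unique[OF trivial_limit_at_top_linorder] by fastforce
  moreover have "G_op S rate (\<lambda>x. f x - scaled_generator S rate f x) (y, i) = (LBINT t:{0..}. v t)"
    unfolding v_def by (rule G_op_eq[OF bounded_cont_borel_measurable[OF d_cont]])
  ultimately show ?thesis using G_op_diff[OF f_cont g_cont, of x] by (simp add: x)
qed

end

theorem lemma5p3:
  fixes S :: "'i::{finite,discrete_topology} \<Rightarrow> real \<Rightarrow> 'y::polish_space \<Rightarrow> 'y"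
    and rate :: "'y \<Rightarrow> real"
    and rate_min rate_max :: real
  assumes semiflow: "\<And>i. jointly_continuous_semiflow (S i)"
    and rate_cont: "continuous_on UNIV rate"
    and rate_min_pos: "rate_min > 0"
    and rate_max_pos: "rate_max > 0"
    and rate_bounds: "\<And>y. rate_min \<le> rate y \<and> rate y \<le> rate_max"
  shows "bij_betw (\<lambda>f x. f x - scaled_generator S rate f x) (Q_domain S) bounded_cont
    \<and> (\<forall>f\<in>bounded_cont.
          inv_into (Q_domain S) (\<lambda>f x. f x - scaled_generator S rate f x) f = G_op S rate f)
    \<and> (\<forall>f\<in>bounded_cont. G_op S rate f \<in> Q_domain S \<and>
          (\<forall>x. G_op S rate f x - scaled_generator S rate (G_op S rate f) x = f x))
    \<and> (\<forall>f\<in>Q_domain S. \<forall>x. G_op S rate f x - G_op S rate (scaled_generator S rate f) x = f x)"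
proof -
  interpret modulated_semiflows S rate rate_min rate_max
    by unfold_locales (use assms in auto)
  let ?T = "\<lambda>f x. f x - scaled_generator S rate f x"
  have TG: "?T (G_op S rate f) = f" if "f \<in> bounded_cont" for f
    using G_op_right_inverse[OF that] by auto
  have GT: "G_op S rate (?T f) = f" if f: "f \<in> Q_domain S" for f
  proof
    have "f \<in> bounded_cont" using f by (simp add: Q_domain_iff)
    then show "G_op S rate (?T f) x = f x" for x
      using G_op_diff[OF _ scaled_generator_bounded_cont[OF f]] G_op_left_inverse[OF f] by simp
  qed
  have T_mem: "?T f \<in> bounded_cont" if "f \<in> Q_domain S" for f
    using that scaled_generator_bounded_cont by (intro bounded_cont_diff) (auto simp: Q_domain_iff)
  have bij: "bij_betw ?T (Q_domain S) bounded_cont"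
    by (rule bij_betw_byWitness[where f'="G_op S rate"])
       (auto simp only: TG GT T_mem G_op_in_Q_domain image_subset_iff)
  moreover have "inv_into (Q_domain S) ?T f = G_op S rate f" if f: "f \<in> bounded_cont" for f
    using inv_into_f_f[OF bij_betw_imp_inj_on[OF bij] G_op_in_Q_domain[OF f]] TG[OF f] by simp
  ultimately show ?thesis
    using G_op_in_Q_domain G_op_right_inverse G_op_left_inverse by blast
qed

end
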